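(* Let $\alpha_1>0$, $\alpha_3\ne0$, $k=1/\alpha_1$, $a=\alpha_3/\alpha_1$, $b=-1-\alpha_2/\alpha_1$, and $f(z)=\frac ka\frac{U'(a,b,kz)}{U(a,b,kz)}-\frac kb$ on $\mathbb{C}\setminus(-\infty,0]$. Then for $x>0$ with $U(a,b,kxe^{i\pi})\neq0$, $$\mu(x):=\frac{1}{2\pi i}\lim_{\varepsilon\to0^+}\big(f(-x+i\varepsilon)-f(-x-i\varepsilon)\big)=\frac{k(kx)^{-b}e^{-kx}}{\Gamma(a+1)\Gamma(a-b+1)}\cdot\frac{1}{U_R(kx)^2+U_I(kx)^2},$$ where $U(a,b,xe^{\pm i\pi})=U_R(x)\pm iU_I(x)$ with, for $b\notin\mathbb{Z}$, $U_R(x)=e^{-x}\Big[\frac{\Gamma(1-b)}{\Gamma(a-b+1)}M(b-a,b,x)-\cos(\pi b)\frac{\Gamma(b-1)}{\Gamma(a)}x^{1-b}M(1-a,2-b,x)\Big]$ and $U_I(x)=\sin(\pi b)\frac{\Gamma(b-1)}{\Gamma(a)}e^{-x}x^{1-b}M(1-a,2-b,x)$ (and by continuity in $b$ for integer $b$). In particular, after extraction of the constant factor $1/(\Gamma(a+1)\Gamma(a-b+1))$, $\mu(x)$ is positive for all such $x>0$.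
   Context: $U(a,b,z)$ is Tricomi's confluent hypergeometric function, analytically continued to $z=xe^{\pm i\pi}$; $M(a,b,z)=\sum_{r\ge0}\frac{(a)_r}{(b)_r}\frac{z^r}{r!}$ is Kummer's function; $'$ denotes derivative in the third argument. When $b=0$ the additive constant $k/b$ is dropped (it does not affect $\mu$). $1/\Gamma$ is interpreted as the entire reciprocal Gamma function. $f$ is the generating function of the sequence $u_1=1$, $u_n=(\alpha_1 n+\alpha_2)u_{n-1}+\alpha_3\sum_{j=1}^{n-1}u_ju_{n-j}$, i.e. $f(z)\sim\sum_{n\ge0}(-1)^nu_nz^{-n}$ with $u_0=1/(\alpha_1+\alpha_2)$. *)

theory Defs
  imports "HOL-Complex_Analysis.Complex_Analysis"
begin

definition kummerM :: "'a::{real_normed_field,banach} \<Rightarrow> 'a \<Rightarrow> 'a \<Rightarrow> 'a" where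
  "kummerM a b z = (\<Sum>r. pochhammer a r / pochhammer b r * z ^ r / fact r)"

text \<open>
  Tricomi's function has a branch point at 0, so it is first defined on the Riemann surface of the
  logarithm: \<open>tricomiU_log a b w\<close> stands for \<open>U(a,b,exp w)\<close>, with
  \<open>z powr (1 - b)\<close> read as \<open>exp ((1 - b) * w)\<close>.  The connection formula in terms of Kummer's
  function defines it for non-integral \<open>b\<close>; its singularities at integral \<open>b\<close> are removable,
  and the value there is the limit in \<open>b\<close> (Abramowitz and Stegun, 13.1.3).
\<close>

definition tricomiU_log_nonint :: "complex \<Rightarrow> complex \<Rightarrow> complex \<Rightarrow> complex" where
  "tricomiU_log_nonint a b w =
     Gamma (1 - b) * rGamma (a - b + 1) * kummerM a b (exp w)
     + Gamma (b - 1) * rGamma a * exp ((1 - b) * w) * kummerM (a - b + 1) (2 - b) (exp w)"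

definition tricomiU_log :: "complex \<Rightarrow> complex \<Rightarrow> complex \<Rightarrow> complex" where
  "tricomiU_log a b w =
     (if b \<notin> \<int> then tricomiU_log_nonint a b w
      else Lim (at b) (\<lambda>\<beta>. tricomiU_log_nonint a \<beta> w))"

text \<open>The principal branch, used only off the cut \<open>(-\<infinity>, 0]\<close>:\<close>

definition tricomiU :: "complex \<Rightarrow> complex \<Rightarrow> complex \<Rightarrow> complex" where
  "tricomiU a b z = tricomiU_log a b (Ln z)"

text \<open>The continuations \<open>U(a, b, x exp(i \<pi>))\<close> and \<open>U(a, b, x exp(-i \<pi>))\<close>, for \<open>x > 0\<close>:\<close>

definition tricomiU_upper :: "real \<Rightarrow> real \<Rightarrow> real \<Rightarrow> complex" where
  "tricomiU_upper a b x = tricomiU_log (of_real a) (of_real b) (of_real (ln x) + \<i> * of_real pi)"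

definition tricomiU_lower :: "real \<Rightarrow> real \<Rightarrow> real \<Rightarrow> complex" where
  "tricomiU_lower a b x = tricomiU_log (of_real a) (of_real b) (of_real (ln x) - \<i> * of_real pi)"

definition U_R_nonint :: "real \<Rightarrow> real \<Rightarrow> real \<Rightarrow> real" where
  "U_R_nonint a b x =
     exp (- x) * (Gamma (1 - b) * rGamma (a - b + 1) * kummerM (b - a) b x
       - cos (pi * b) * (Gamma (b - 1) * rGamma a) * x powr (1 - b) * kummerM (1 - a) (2 - b) x)"

definition U_I_nonint :: "real \<Rightarrow> real \<Rightarrow> real \<Rightarrow> real" where
  "U_I_nonint a b x =
     sin (pi * b) * (Gamma (b - 1) * rGamma a) * exp (- x) * x powr (1 - b)
       * kummerM (1 - a) (2 - b) x"

definition U_R :: "real \<Rightarrow> real \<Rightarrow> real \<Rightarrow> real" where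
  "U_R a b x =
     (if b \<notin> \<int> then U_R_nonint a b x else Lim (at b) (\<lambda>\<beta>. U_R_nonint a \<beta> x))"

definition U_I :: "real \<Rightarrow> real \<Rightarrow> real \<Rightarrow> real" where
  "U_I a b x =
     (if b \<notin> \<int> then U_I_nonint a b x else Lim (at b) (\<lambda>\<beta>. U_I_nonint a \<beta> x))"

text \<open>The additive constant \<open>k / b\<close> is dropped when \<open>b = 0\<close>; it cancels in the jump below.\<close>

definition gen_fun :: "real \<Rightarrow> real \<Rightarrow> real \<Rightarrow> complex \<Rightarrow> complex" where
  "gen_fun k a b z =
     of_real (k / a) * (deriv (tricomiU (of_real a) (of_real b)) (of_real k * z)
                        / tricomiU (of_real a) (of_real b) (of_real k * z))
     - (if b = 0 then 0 else of_real (k / b))"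

definition jump :: "(complex \<Rightarrow> complex) \<Rightarrow> real \<Rightarrow> real \<Rightarrow> complex" where
  "jump f x \<epsilon> = f (- of_real x + \<i> * of_real \<epsilon>) - f (- of_real x - \<i> * of_real \<epsilon>)"

definition stieltjes_density :: "(complex \<Rightarrow> complex) \<Rightarrow> real \<Rightarrow> complex" where
  "stieltjes_density f x = 1 / (2 * of_real pi * \<i>) * Lim (at_right 0) (jump f x)"

end

(* Write U in terms of the regularised Kummer function sum_r (a)_r z^r / (Gamma(b + r) r!), which is
   entire in a, b and z.  This gives U(a,b,exp w) = pi / sin(pi b) * N(b,w), where N is entire in b and
   in w and vanishes at every integer b; by Taylor's formula in b the singularity is removable,
   locally uniformly in w, so identities between U and its w-derivative pass from non-integral to
   integral b.

   The two boundary values of f differ by a Wronskian of U(a,b,x exp(i pi)) and U(a,b,x exp(-i pi)),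
   divided by their product U_R^2 + U_I^2.  These continuations are two combinations of the same pair
   of Kummer solutions, whose Wronskian is elementary because it satisfies a first order equation
   by Kummer's differential equation. *)

theory Submission
  imports Defs
begin

text \<open>The coordinate w = Ln z removes the branch point: U becomes entire in w, and the two
  sides of the cut at -x become the points ln x + i pi and ln x - i pi. Both are sent to -x by exp,
  so the Kummer functions take the same values on both sides and only the factor exp((1 - b) w)
  jumps. The obstacle is integral b. There the two terms of the connection formula degenerate:
  1/Gamma kills the leading terms of one series and makes the two solutions proportional, so U is
  available only as a limit in b, while f also contains the derivative of U, about which a pointwise
  limit says nothing. The constant in the density comes from the two connection coefficients
  1/Gamma(a) and 1/Gamma(a - b + 1); the factor k/a in f turns the first into 1/Gamma(a +
  1).\<close>

section \<open>The regularised Kummer series: convergence, continuity, holomorphy\<close>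

definition kummer_term :: "complex \<Rightarrow> complex \<Rightarrow> complex \<Rightarrow> nat \<Rightarrow> complex" where
  "kummer_term a b z r = pochhammer a r * rGamma (b + of_nat r) * z ^ r / fact r"

definition kummerMr :: "complex \<Rightarrow> complex \<Rightarrow> complex \<Rightarrow> complex" where
  "kummerMr a b z = (\<Sum>r. kummer_term a b z r)"

lemma kummer_term_Suc:
  assumes "b + of_nat r \<noteq> 0"
  shows "kummer_term a b z (Suc r) =
    kummer_term a b z r * ((a + of_nat r) * z / ((b + of_nat r) * of_nat (Suc r)))"
proof -
  have "rGamma (b + of_nat r) = (b + of_nat r) * rGamma (b + of_nat (Suc r))"
    using rGamma_plus1[of "b + of_nat r"] by (simp add: add_ac)
  then show ?thesis
    using assms by (simp add: kummer_term_def pochhammer_Suc divide_simps del: of_nat_Suc)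
qed

text \<open>Since A is at most r/2, the ratio is at most (3r/2) A / ((r/2) (r + 1)) = 3A / (r + 1),
  and 6A <= r brings this below 1/2. The index depends only on the radius A, which makes the later
  majorant uniform in all three arguments.\<close>

lemma kummer_ratio_bound:
  fixes a b z :: complex
  assumes "norm a \<le> A" "norm b \<le> A" "norm z \<le> A" "1 \<le> A" "6 * A \<le> real r"
  shows "norm ((a + of_nat r) * z / ((b + of_nat r) * of_nat (Suc r))) \<le> 1 / 2"
    and "b + of_nat r \<noteq> 0"
proof -
  have b: "norm (b + of_nat r) \<ge> real r / 2"
    using norm_triangle_ineq4[of "b + of_nat r" b] assms by simp
  then show "b + of_nat r \<noteq> 0"
    using assms by (cases "b + of_nat r = 0") auto
  have a: "norm (a + of_nat r) \<le> 3 / 2 * real r"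
    using norm_triangle_ineq[of a "of_nat r"] assms by simp
  have "norm (a + of_nat r) * norm z \<le> (3 / 2 * real r) * A"
    using a assms by (intro mult_mono) auto
  also have "\<dots> = real r / 4 * (6 * A)"
    by simp
  also have "\<dots> \<le> real r / 4 * real (Suc r)"
    using assms by (intro mult_left_mono) auto
  also have "\<dots> = 1 / 2 * (real r / 2 * real (Suc r))"
    by simp
  also have "\<dots> \<le> 1 / 2 * (norm (b + of_nat r) * real (Suc r))"
    using b by (intro mult_left_mono mult_right_mono) auto
  finally have *: "norm (a + of_nat r) * norm z \<le> 1 / 2 * (norm (b + of_nat r) * real (Suc r))" .
  have "0 < norm (b + of_nat r) * real (Suc r)"
    using \<open>b + of_nat r \<noteq> 0\<close> by simp
  then show "norm ((a + of_nat r) * z / ((b + of_nat r) * of_nat (Suc r))) \<le> 1 / 2"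
    unfolding norm_mult norm_divide norm_of_nat
    using * by (simp only: pos_divide_le_eq)
qed

lemma continuous_on_kummer_term:
  "continuous_on S (\<lambda>(a, b, z). kummer_term a b z r)"
  unfolding kummer_term_def case_prod_unfold pochhammer_prod
  by (intro continuous_intros continuous_on_compose2[OF continuous_on_rGamma]) auto

text \<open>Only a tail is dominated: for small r the factor b + r may vanish, and the recurrence
  then cannot be divided by it. From N on the ratio is at most 1/2, and the N-th term is bounded on
  K by compactness.\<close>

lemma kummer_term_dominated:
  assumes "compact K"
  obtains M N where "summable M"
    "\<And>a b z r. (a, b, z) \<in> K \<Longrightarrow> N \<le> r \<Longrightarrow> norm (kummer_term a b z r) \<le> M r"
proof -
  obtain A0 where A0: "\<And>p. p \<in> K \<Longrightarrow> norm p \<le> A0"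
    using compact_imp_bounded[OF assms] unfolding bounded_iff by blast
  define A where "A = max 1 A0"
  have A: "norm a \<le> A" "norm b \<le> A" "norm z \<le> A" if "(a, b, z) \<in> K" for a b z
  proof -
    have "norm (a, b, z) \<le> A"
      using A0[OF that] by (simp add: A_def)
    moreover have "norm a \<le> norm (a, b, z)" "norm (b, z) \<le> norm (a, b, z)"
      "norm b \<le> norm (b, z)" "norm z \<le> norm (b, z)"
      using norm_fst_le[of a "(b, z)"] norm_snd_le[of "(b, z)" a] norm_fst_le[of b z]
        norm_snd_le[of z b] by auto
    ultimately show "norm a \<le> A" "norm b \<le> A" "norm z \<le> A"
      by linarith+
  qed
  obtain N :: nat where N: "6 * A \<le> real N"
    using real_arch_simple by blast
  have "compact ((\<lambda>(a, b, z). kummer_term a b z N) ` K)"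
    by (intro compact_continuous_image continuous_on_kummer_term assms)
  then obtain C where "\<forall>x\<in>(\<lambda>(a, b, z). kummer_term a b z N) ` K. norm x \<le> C"
    using compact_imp_bounded bounded_iff by metis
  then have C: "norm (kummer_term a b z N) \<le> C" if "(a, b, z) \<in> K" for a b z
    using that by fastforce
  \<comment> \<open>The majorant is C (1/2)^(r - N), written without truncated subtraction.\<close>
  have bound: "norm (kummer_term a b z r) \<le> C * 2 ^ N * (1 / 2) ^ r"
    if p: "(a, b, z) \<in> K" and "N \<le> r" for a b z r
    using \<open>N \<le> r\<close>
  proof (induction r rule: dec_induct)
    case base
    then show ?case
      using C[OF p] by (simp add: power_one_over)
  next
    case (step r)
    have r: "6 * A \<le> real r"
      using N step by linarith
    have A1: "1 \<le> A"
      by (simp add: A_def)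
    note R = kummer_ratio_bound[OF A[OF p] A1 r]
    have "norm (kummer_term a b z (Suc r)) \<le> (C * 2 ^ N * (1 / 2) ^ r) * (1 / 2)"
      unfolding kummer_term_Suc[OF R(2)] norm_mult[of "kummer_term a b z r"]
      using R(1) step.IH by (intro mult_mono) (auto intro: order_trans[OF norm_ge_zero])
    then show ?case
      by simp
  qed
  show thesis
    by (rule that[of "\<lambda>r. C * 2 ^ N * (1 / 2) ^ r" N])
      (use bound in \<open>auto intro!: summable_mult summable_geometric\<close>)
qed

lemma uniform_limit_kummerMr:
  assumes "compact K"
  shows "uniform_limit K (\<lambda>n (a, b, z). \<Sum>r<n. kummer_term a b z r)
           (\<lambda>(a, b, z). kummerMr a b z) sequentially"
proof -
  obtain M N where M: "summable M"
    "\<And>a b z r. (a, b, z) \<in> K \<Longrightarrow> N \<le> r \<Longrightarrow> norm (kummer_term a b z r) \<le> M r"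
    using kummer_term_dominated[OF assms] by metis
  show ?thesis
    unfolding kummerMr_def case_prod_unfold
    by (rule Weierstrass_m_test_ev[OF _ M(1)])
      (use M(2) in \<open>auto simp: eventually_sequentially intro!: exI[of _ N]\<close>)
qed

lemma summable_norm_kummer_term: "summable (\<lambda>r. norm (kummer_term a b z r))"
proof -
  obtain M N where M: "summable M"
    "\<And>a' b' z' r. (a', b', z') \<in> {(a, b, z)} \<Longrightarrow> N \<le> r \<Longrightarrow> norm (kummer_term a' b' z' r) \<le> M r"
    using kummer_term_dominated[of "{(a, b, z)}"] by (metis compact_sing)
  then show ?thesis
    by (intro summable_comparison_test[OF _ M(1)]) auto
qed

lemma summable_kummer_term: "summable (kummer_term a b z)"
  using summable_norm_cancel[OF summable_norm_kummer_term] .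

lemma continuous_on_kummerMr [continuous_intros]:
  assumes "continuous_on S A" "continuous_on S B" "continuous_on S Z"
  shows "continuous_on S (\<lambda>s. kummerMr (A s) (B s) (Z s))"
proof -
  have "continuous_on (cball 0 R) (\<lambda>(a, b, z). kummerMr a b z)" for R
    by (rule uniform_limit_theorem[OF _ uniform_limit_kummerMr])
      (auto simp: case_prod_unfold kummer_term_def pochhammer_prod
        intro!: always_eventually continuous_intros continuous_on_compose2[OF continuous_on_rGamma])
  then have "continuous_on (ball 0 R) (\<lambda>(a, b, z). kummerMr a b z)" for R
    by (rule continuous_on_subset[where s = "cball 0 R"]) auto
  then have "isCont (\<lambda>(a, b, z). kummerMr a b z) p" for p
    by (auto simp: continuous_on_eq_continuous_at intro!: exI[of _ "norm p + 1"]
        dest: meta_spec[of _ "norm p + 1"])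
  then have "continuous_on UNIV (\<lambda>(a, b, z). kummerMr a b z)"
    by (simp add: continuous_at_imp_continuous_on)
  from continuous_on_compose2[OF this continuous_on_Pair[OF assms(1) continuous_on_Pair[OF assms(2,3)]]]
  show ?thesis
    by simp
qed

text \<open>The partial sums are holomorphic in s, and their uniform convergence on compact sets of
  triples pulls back along s to (A s, B s, Z s). This covers holomorphy in the parameter b and in
  the argument at once.\<close>

lemma holomorphic_on_kummerMr [holomorphic_intros]:
  assumes "open S" "A holomorphic_on S" "B holomorphic_on S" "Z holomorphic_on S"
  shows "(\<lambda>s. kummerMr (A s) (B s) (Z s)) holomorphic_on S"
proof (rule holomorphic_uniform_sequence[OF \<open>open S\<close>])
  show "(\<lambda>s. \<Sum>r<n. kummer_term (A s) (B s) (Z s) r) holomorphic_on S" for n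
    unfolding kummer_term_def pochhammer_prod by (intro holomorphic_intros assms) auto
  fix x assume "x \<in> S"
  then obtain d where d: "0 < d" "cball x d \<subseteq> S"
    using \<open>open S\<close> open_contains_cball by metis
  define g where "g = (\<lambda>s. (A s, B s, Z s))"
  have "continuous_on (cball x d) g"
    unfolding g_def using assms d
    by (intro continuous_on_Pair) (auto intro: holomorphic_on_imp_continuous_on holomorphic_on_subset)
  then have "compact (g ` cball x d)"
    by (intro compact_continuous_image) auto
  from uniform_limit_kummerMr[OF this]
  have "uniform_limit (cball x d) (\<lambda>n s. \<Sum>r<n. kummer_term (A s) (B s) (Z s) r)
    (\<lambda>s. kummerMr (A s) (B s) (Z s)) sequentially"
    unfolding uniform_limit_iff g_def by simp
  with d show "\<exists>d>0. cball x d \<subseteq> S \<and> uniform_limit (cball x d)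
      (\<lambda>n s. \<Sum>r<n. kummer_term (A s) (B s) (Z s) r) (\<lambda>s. kummerMr (A s) (B s) (Z s)) sequentially"
    by blast
qed

section \<open>Kummer's function and Kummer's transformation\<close>

lemma kummer_term_Gamma:
  assumes "b \<notin> \<int>\<^sub>\<le>\<^sub>0"
  shows "pochhammer a r / pochhammer b r * z ^ r / fact r = Gamma b * kummer_term a b z r"
proof -
  have "rGamma b \<noteq> 0"
    using assms by (simp add: rGamma_eq_zero_iff)
  then show ?thesis
    using pochhammer_rGamma[of b r] by (auto simp: kummer_term_def Gamma_def field_simps)
qed

lemma kummerM_eq_kummerMr:
  assumes "b \<notin> \<int>\<^sub>\<le>\<^sub>0"
  shows "kummerM a b z = Gamma b * kummerMr a b z"
  unfolding kummerM_def kummerMr_def kummer_term_Gamma[OF assms]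
  by (rule suminf_mult[OF summable_kummer_term])

lemma summable_norm_kummerM:
  assumes "b \<notin> \<int>\<^sub>\<le>\<^sub>0"
  shows "summable (\<lambda>r. norm (pochhammer a r / pochhammer b r * z ^ r / fact r :: complex))"
  unfolding kummer_term_Gamma[OF assms] norm_mult
  by (intro summable_mult summable_norm_kummer_term)

lemma kummerM_of_real:
  fixes a b x :: real
  assumes "b \<notin> \<int>\<^sub>\<le>\<^sub>0"
  shows "kummerM (of_real a) (of_real b) (of_real x) = complex_of_real (kummerM a b x)"
proof -
  let ?t = "\<lambda>r. pochhammer a r / pochhammer b r * x ^ r / fact r"
  have "(of_real b :: complex) \<notin> \<int>\<^sub>\<le>\<^sub>0"
    using assms by (simp add: of_real_in_nonpos_Ints_iff)
  from summable_norm_cancel[OF summable_norm_kummerM[OF this, of "of_real a" "of_real x"]]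
  have "summable (\<lambda>r. complex_of_real (?t r))"
    by (simp add: pochhammer_of_real)
  then have "summable ?t"
    by (simp only: summable_complex_of_real)
  from suminf_of_real[OF this, where 'a = complex] show ?thesis
    by (simp add: kummerM_def pochhammer_of_real)
qed

text \<open>This is the Chu-Vandermonde sum 2F1(-n, c; b; 1). Pascal's rule splits it into the sum
  for n and a shifted sum with parameters c + 1 and b + 1; the difference b - c is unchanged, so the
  induction hypothesis, general in b and c, applies to both.\<close>

lemma pochhammer_alternating_sum:
  fixes c b :: complex
  assumes "b \<notin> \<int>\<^sub>\<le>\<^sub>0"
  shows "(\<Sum>i\<le>n. of_nat (n choose i) * (-1) ^ i * pochhammer c i / pochhammer b i)
           = pochhammer (b - c) n / pochhammer b n"
  using assms
proof (induction n arbitrary: b c)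
  case 0
  then show ?case by simp
next
  case (Suc n)
  let ?t = "\<lambda>c b i. (-1) ^ i * pochhammer c i / pochhammer b i"
  have b0: "b \<noteq> 0"
    using Suc.prems by auto
  have b1: "b + 1 \<notin> \<int>\<^sub>\<le>\<^sub>0"
    using Suc.prems plus_one_in_nonpos_Ints_imp by blast
  have bn: "pochhammer (b + 1) n \<noteq> 0"
    using b1 pochhammer_eq_0_imp_nonpos_Int by blast
  have "(\<Sum>i\<le>Suc n. of_nat (Suc n choose i) * ?t c b i) =
      (\<Sum>i\<le>n. of_nat (n choose i) * ?t c b i) + (\<Sum>i\<le>n. of_nat (n choose i) * ?t c b (Suc i))"
  proof -
    have "(\<Sum>i\<le>Suc n. of_nat (Suc n choose i) * ?t c b i) =
        ?t c b 0 + (\<Sum>i\<le>n. of_nat (Suc n choose Suc i) * ?t c b (Suc i))"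
      by (subst sum.atMost_Suc_shift) simp
    also have "(\<Sum>i\<le>n. of_nat (Suc n choose Suc i) * ?t c b (Suc i)) =
        (\<Sum>i\<le>n. of_nat (n choose Suc i) * ?t c b (Suc i)) + (\<Sum>i\<le>n. of_nat (n choose i) * ?t c b (Suc i))"
      by (simp add: sum.distrib[symmetric] algebra_simps add_divide_distrib)
    also have "?t c b 0 + ((\<Sum>i\<le>n. of_nat (n choose Suc i) * ?t c b (Suc i)) + (\<Sum>i\<le>n. of_nat (n choose i) * ?t c b (Suc i)))
        = (\<Sum>i\<le>Suc n. of_nat (n choose i) * ?t c b i) + (\<Sum>i\<le>n. of_nat (n choose i) * ?t c b (Suc i))"
      by (subst sum.atMost_Suc_shift) simp
    finally show ?thesis
      by (simp add: binomial_eq_0)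
  qed
  also have "(\<Sum>i\<le>n. of_nat (n choose i) * ?t c b (Suc i)) =
      - (c / b) * (\<Sum>i\<le>n. of_nat (n choose i) * ?t (c + 1) (b + 1) i)"
    unfolding sum_distrib_left by (intro sum.cong refl) (simp add: pochhammer_rec)
  also have "(\<Sum>i\<le>n. of_nat (n choose i) * ?t (c + 1) (b + 1) i) = pochhammer (b - c) n / pochhammer (b + 1) n"
    using Suc.IH[OF b1, of "c + 1"] by (simp add: mult.assoc)
  also have "(\<Sum>i\<le>n. of_nat (n choose i) * ?t c b i) = pochhammer (b - c) n / pochhammer b n"
    using Suc.IH[OF Suc.prems, of c] by (simp add: mult.assoc)
  \<comment> \<open>Over the denominator \<open>pochhammer b (Suc n)\<close> the two fractions
    contribute b + n and -c, whose sum is the last factor of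
    \<open>pochhammer (b - c) (Suc n)\<close>.\<close>
  also have "pochhammer (b - c) n / pochhammer b n + - (c / b) * (pochhammer (b - c) n / pochhammer (b + 1) n)
      = pochhammer (b - c) (Suc n) / pochhammer b (Suc n)"
  proof -
    have "b * pochhammer (b + 1) n = pochhammer b n * (b + of_nat n)"
      by (metis pochhammer_rec pochhammer_Suc)
    moreover have "pochhammer b n \<noteq> 0" 
      using Suc.prems pochhammer_eq_0_imp_nonpos_Int by blast
    moreover have "b + of_nat n \<noteq> 0"
      using Suc.prems by (metis add_eq_0_iff minus_of_nat_in_nonpos_Ints add.commute minus_minus)
    ultimately have "1 / pochhammer b n = (b + of_nat n) / pochhammer b (Suc n)"
      "1 / pochhammer (b + 1) n = b / pochhammer b (Suc n)"
      using b0 bn by (auto simp: pochhammer_rec[of b] field_simps)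
    then have "pochhammer (b - c) n / pochhammer b n = pochhammer (b - c) n * ((b + of_nat n) / pochhammer b (Suc n))"
      "pochhammer (b - c) n / pochhammer (b + 1) n = pochhammer (b - c) n * (b / pochhammer b (Suc n))"
      by (metis divide_inverse inverse_eq_divide)+
    then show ?thesis
      using b0 by (simp add: pochhammer_Suc[of "b - c"] diff_divide_distrib[symmetric] algebra_simps)
  qed
  finally show ?case
    by (simp add: mult.assoc)
qed

text \<open>In the Cauchy product with the exponential series the coefficient of z^k is a
  Chu-Vandermonde sum. On the cut the argument is -x, and this identity produces the factor exp(-x)
  and the positive arguments in \<open>U_R\<close> and \<open>U_I\<close>.\<close>

theorem kummer_transformation:
  fixes a b z :: complex
  assumes b: "b \<notin> \<int>\<^sub>\<le>\<^sub>0"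
  shows "kummerM a b z = exp z * kummerM (b - a) b (- z)"
proof -
  let ?t = "\<lambda>r. pochhammer (b - a) r / pochhammer b r * (- z) ^ r / fact r"
  let ?e = "\<lambda>r. z ^ r /\<^sub>R fact r"
  have "kummerM (b - a) b (- z) * exp z = (\<Sum>k. \<Sum>i\<le>k. ?t i * ?e (k - i))"
    unfolding kummerM_def exp_def
    by (intro Cauchy_product summable_norm_kummerM b summable_norm_exp)
  also have "(\<lambda>k. \<Sum>i\<le>k. ?t i * ?e (k - i)) = (\<lambda>k. pochhammer a k / pochhammer b k * z ^ k / fact k)"
  proof
    fix k
    have "?t i * ?e (k - i) =
        z ^ k / fact k * (of_nat (k choose i) * (-1) ^ i * pochhammer (b - a) i / pochhammer b i)"
      if "i \<le> k" for i
    proof -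
      have "(- z) ^ i * z ^ (k - i) = (-1) ^ i * z ^ k"
        using that by (metis power_minus mult.assoc le_add_diff_inverse power_add)
      moreover have "of_nat (k choose i) = (fact k / (fact i * fact (k - i)) :: complex)"
        using that by (rule binomial_fact)
      ultimately show ?thesis
        by (simp add: scaleR_conv_of_real divide_simps mult_ac)
    qed
    then have "(\<Sum>i\<le>k. ?t i * ?e (k - i)) = z ^ k / fact k *
        (\<Sum>i\<le>k. of_nat (k choose i) * (-1) ^ i * pochhammer (b - a) i / pochhammer b i)"
      by (simp add: sum_distrib_left)
    also have "\<dots> = z ^ k / fact k * (pochhammer a k / pochhammer b k)"
      unfolding pochhammer_alternating_sum[OF b] by simp
    also have "\<dots> = pochhammer a k / pochhammer b k * z ^ k / fact k"
      by (simp add: mult_ac)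
    finally show "(\<Sum>i\<le>k. ?t i * ?e (k - i)) = pochhammer a k / pochhammer b k * z ^ k / fact k" .
  qed
  finally show ?thesis
    unfolding kummerM_def by (simp add: mult.commute)
qed

section \<open>Derivative, Kummer's equation and the Wronskian\<close>

text \<open>Unlike M' = (a/b) M(a + 1, b + 1, z), this has no division by b: the regularisation
  absorbs it.\<close>

definition kummerMr' :: "complex \<Rightarrow> complex \<Rightarrow> complex \<Rightarrow> complex" where
  "kummerMr' a b z = a * kummerMr (a + 1) (b + 1) z"

lemma kummer_term_Suc_shift:
  "of_nat (Suc r) * kummer_term a b z (Suc r) = a * z * kummer_term (a + 1) (b + 1) z r"
  by (simp add: kummer_term_def pochhammer_rec add_ac del: of_nat_Suc) (simp add: add_ac)

lemma kummerMr_has_field_derivative [derivative_intros]: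
  "(kummerMr a b has_field_derivative kummerMr' a b z) (at z)"
proof -
  define c where "c a b r = pochhammer a r * rGamma (b + of_nat r) / fact r" for a b :: complex and r
  have c: "kummer_term a b z = (\<lambda>r. c a b r * z ^ r)" for a b z
    by (auto simp: kummer_term_def c_def)
  have "diffs (c a b) r = a * c (a + 1) (b + 1) r" for r
    by (simp add: diffs_def c_def pochhammer_rec add_ac del: of_nat_Suc) (simp add: add_ac)
  then have "(\<Sum>r. diffs (c a b) r * z ^ r) = kummerMr' a b z"
    unfolding kummerMr'_def kummerMr_def
    by (subst suminf_mult[OF summable_kummer_term, symmetric]) (simp add: c mult.assoc)
  moreover have "summable (\<lambda>r. c a b r * y ^ r)" for y
    using summable_kummer_term[of a b y] by (simp add: c)
  moreover have "kummerMr a b = (\<lambda>z. \<Sum>r. c a b r * z ^ r)"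
    by (simp add: fun_eq_iff kummerMr_def c)
  ultimately show ?thesis
    using termdiffs_strong_converges_everywhere[of "c a b" z] by simp
qed

text \<open>The Euler operator \<theta> = z d/dz multiplies the r-th term by r. The shifted series
  starts at r = 1, and the term at r = 0 that it omits is zero.\<close>

lemma kummer_term_theta_sums:
  "(\<lambda>r. of_nat r * kummer_term a b z r) sums (z * kummerMr' a b z)"
proof -
  have "(\<lambda>r. a * z * kummer_term (a + 1) (b + 1) z r) sums (a * z * kummerMr (a + 1) (b + 1) z)"
    unfolding kummerMr_def by (intro sums_mult summable_sums summable_kummer_term)
  then show ?thesis
    unfolding kummer_term_Suc_shift[symmetric]
    by (subst (asm) sums_Suc_iff) (simp add: kummerMr'_def mult_ac)
qed

text \<open>Termwise this is the factored form (\<theta> + b) M' = (\<theta> + a) M, with \<theta> =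
  z d/dz and M' a multiple of the series at a + 1, b + 1; the factors r + b and r + a shift the
  reciprocal Gamma and the Pochhammer symbol by one.\<close>

lemma kummer_equation:
  "z * (a * kummerMr' (a + 1) (b + 1) z) + (b - z) * kummerMr' a b z = a * kummerMr a b z"
proof -
  have t: "kummer_term a b z sums kummerMr a b z" for a b
    unfolding kummerMr_def by (intro summable_sums summable_kummer_term)
  have A: "(of_nat r + b) * rGamma (b + 1 + of_nat r) = rGamma (b + of_nat r)"
    "a * pochhammer (a + 1) r = (of_nat r + a) * pochhammer a r" for r
    using rGamma_plus1[of "b + of_nat r"]
    by (simp add: add_ac) (metis pochhammer_rec pochhammer_Suc add.commute mult.commute)
  have *: "a * (of_nat r * kummer_term (a + 1) (b + 1) z r) + b * (a * kummer_term (a + 1) (b + 1) z r) =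
      of_nat r * kummer_term a b z r + a * kummer_term a b z r" for r
  proof -
    have "a * (of_nat r * kummer_term (a + 1) (b + 1) z r) + b * (a * kummer_term (a + 1) (b + 1) z r) =
        (a * pochhammer (a + 1) r) * ((of_nat r + b) * rGamma (b + 1 + of_nat r)) * z ^ r / fact r"
      by (simp add: kummer_term_def field_simps)
    also have "\<dots> = (of_nat r + a) * kummer_term a b z r"
      unfolding A by (simp add: kummer_term_def)
    finally show ?thesis
      by (simp add: algebra_simps)
  qed
  have "(\<lambda>r. a * (of_nat r * kummer_term (a + 1) (b + 1) z r) + b * (a * kummer_term (a + 1) (b + 1) z r))
      sums (a * (z * kummerMr' (a + 1) (b + 1) z) + b * (a * kummerMr (a + 1) (b + 1) z))"
    by (intro sums_add sums_mult kummer_term_theta_sums t)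
  moreover have "(\<lambda>r. of_nat r * kummer_term a b z r + a * kummer_term a b z r)
      sums (z * kummerMr' a b z + a * kummerMr a b z)"
    by (intro sums_add sums_mult kummer_term_theta_sums t)
  ultimately have "a * (z * kummerMr' (a + 1) (b + 1) z) + b * (a * kummerMr (a + 1) (b + 1) z) =
      z * kummerMr' a b z + a * kummerMr a b z"
    unfolding * by (rule sums_unique2)
  then show ?thesis
    by (simp add: kummerMr'_def algebra_simps)
qed

lemma kummerMr'_has_field_derivative [derivative_intros]:
  "(kummerMr' a b has_field_derivative a * kummerMr' (a + 1) (b + 1) z) (at z)"
proof -
  have "kummerMr' a b = (\<lambda>z. a * kummerMr (a + 1) (b + 1) z)"
    by (simp add: fun_eq_iff kummerMr'_def)
  then show ?thesis
    by (simp add: DERIV_cmult kummerMr_has_field_derivative)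
qed

lemma kummerMr_0: "kummerMr a b 0 = rGamma b"
proof -
  have "kummerMr a b 0 = (\<Sum>r\<in>{0}. kummer_term a b 0 r)"
    unfolding kummerMr_def by (intro suminf_finite) (auto simp: kummer_term_def)
  then show ?thesis
    by (simp add: kummer_term_def)
qed

text \<open>The left-hand side is \<open>z powr b\<close> times the Wronskian of the two solutions
  \<open>kummerMr a b z\<close> and \<open>z powr (1 - b) * kummerMr (a - b + 1) (2 - b) z\<close>.\<close>

lemma kummerMr_wronskian:
  defines "c \<equiv> \<lambda>a b. a - b + (1 :: complex)"
  shows "(1 - b) * kummerMr a b z * kummerMr (c a b) (2 - b) z
      + z * (kummerMr a b z * kummerMr' (c a b) (2 - b) z - kummerMr' a b z * kummerMr (c a b) (2 - b) z)
    = sin (of_real pi * b) / of_real pi * exp z"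
proof -
  define d where "d = 2 - b"
  define e where "e = c a b"
  let ?M = "kummerMr a b" and ?M' = "kummerMr' a b" and ?M'' = "\<lambda>z. a * kummerMr' (a + 1) (b + 1) z"
  let ?N = "kummerMr e d" and ?N' = "kummerMr' e d" and ?N'' = "\<lambda>z. e * kummerMr' (e + 1) (d + 1) z"
  define H where "H z = (1 - b) * ?M z * ?N z + z * (?M z * ?N' z - ?M' z * ?N z)" for z
  have "(H has_field_derivative H z) (at z)" for z
  proof -
    have "(H has_field_derivative (1 - b) * (?M' z * ?N z + ?M z * ?N' z) + (?M z * ?N' z - ?M' z * ?N z)
        + z * (?M z * ?N'' z - ?M'' z * ?N z)) (at z)"
      unfolding H_def[abs_def] by (auto intro!: derivative_eq_intros simp: algebra_simps)
    moreover have "(1 - b) * (?M' z * ?N z + ?M z * ?N' z) + (?M z * ?N' z - ?M' z * ?N z)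
        + z * (?M z * ?N'' z - ?M'' z * ?N z) = H z"
    proof -
      have "z * ?M'' z = a * ?M z - (b - z) * ?M' z" "z * ?N'' z = e * ?N z - (d - z) * ?N' z"
        using kummer_equation[of z a b] kummer_equation[of z e d] by (auto simp: algebra_simps)
      then have "?M z * (z * ?N'' z) - (z * ?M'' z) * ?N z =
        ?M z * (e * ?N z - (d - z) * ?N' z) - (a * ?M z - (b - z) * ?M' z) * ?N z"
        by simp
      then show ?thesis
        unfolding H_def by (simp add: e_def c_def d_def algebra_simps)
    qed
    ultimately show ?thesis
      by simp
  qed
  then have "((\<lambda>z. H z * exp (- z)) has_field_derivative 0) (at z within UNIV)" for z
    by (auto intro!: derivative_eq_intros)
  from has_field_derivative_zero_constant[OF convex_UNIV this]
  obtain C where C: "\<And>z. H z * exp (- z) = C"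
    by auto
  \<comment> \<open>With the powers of z cleared, H is entire and can be evaluated at the singular
    point 0 of the equation, where only the first summand survives. The reflection formula then
    gives the sine.\<close>
  have "C = (1 - b) * rGamma b * rGamma (2 - b)"
    using C[of 0] by (simp add: H_def kummerMr_0 d_def)
  also have "\<dots> = rGamma b * rGamma (1 - b)"
    using rGamma_plus1[of "1 - b"] by (simp add: mult.commute mult.left_commute)
  finally have "H z = sin (of_real pi * b) / of_real pi * exp z"
    using C[of z] rGamma_reflection_complex[of b] by (simp add: exp_minus field_simps)
  then show ?thesis
    by (simp add: H_def e_def d_def)
qed

section \<open>The connection formula and its degeneration at integral b\<close>

text \<open>The first n terms vanish because 1/Gamma is zero at 1 - n + r for r < n. Shifting the
  index by n leaves a multiple of the other solution.\<close>

lemma kummerMr_at_nonpos_Int: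
  "kummerMr (a - of_nat n) (1 - of_nat n) z = pochhammer (a - of_nat n) n * z ^ n * kummerMr a (1 + of_nat n) z"
proof -
  have "kummerMr (a - of_nat n) (1 - of_nat n) z =
      (\<Sum>s. kummer_term (a - of_nat n) (1 - of_nat n) z (s + n))
      + (\<Sum>r<n. kummer_term (a - of_nat n) (1 - of_nat n) z r)"
    unfolding kummerMr_def by (rule suminf_split_initial_segment[OF summable_kummer_term])
  also have "(\<Sum>r<n. kummer_term (a - of_nat n) (1 - of_nat n) z r) = 0"
  proof (intro sum.neutral ballI)
    fix r assume "r \<in> {..<n}"
    then have "1 - of_nat n + of_nat r = (- of_nat (n - Suc r) :: complex)"
      by (simp add: of_nat_diff)
    then have "1 - of_nat n + of_nat r \<in> (\<int>\<^sub>\<le>\<^sub>0 :: complex set)"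
      by simp
    then show "kummer_term (a - of_nat n) (1 - of_nat n) z r = 0"
      by (simp add: kummer_term_def rGamma_eq_zero_iff)
  qed
  also have "kummer_term (a - of_nat n) (1 - of_nat n) z (s + n) =
      pochhammer (a - of_nat n) n * z ^ n * kummer_term a (1 + of_nat n) z s" for s
  proof -
    have "pochhammer (a - of_nat n) (s + n) = pochhammer (a - of_nat n) n * pochhammer a s"
      using pochhammer_product'[of "a - of_nat n" n s] by (simp add: add.commute)
    \<comment> \<open>The shift exchanges the reciprocal Gamma and the factorial: both sides carry 1
      / (s! (n + s)!).\<close>
    moreover have "rGamma (1 + of_nat m) = (1 / fact m :: complex)" for m
      by (simp add: rGamma_inverse_Gamma Gamma_fact inverse_eq_divide)
    note this[of s] this[of "n + s"]
    ultimately show ?thesis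
      by (simp add: kummer_term_def power_add add_ac mult_ac)
  qed
  then have "(\<Sum>s. kummer_term (a - of_nat n) (1 - of_nat n) z (s + n)) =
      pochhammer (a - of_nat n) n * z ^ n * kummerMr a (1 + of_nat n) z"
    unfolding kummerMr_def by (simp add: suminf_mult[OF summable_kummer_term])
  finally show ?thesis
    by simp
qed

text \<open>This is the N(b, w) of the overview.\<close>

definition connection_bracket :: "complex \<Rightarrow> complex \<Rightarrow> complex \<Rightarrow> complex" where
  "connection_bracket a b w = rGamma (a - b + 1) * kummerMr a b (exp w)
     - rGamma a * exp ((1 - b) * w) * kummerMr (a - b + 1) (2 - b) (exp w)"

text \<open>Regularising the two series leaves Gamma(1 - b) Gamma(b) and Gamma(b - 1) Gamma(2 - b).
  The reflection formula at b and at b - 1 shows that they are opposite, hence one common prefactor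
  and a minus sign in the bracket.\<close>

lemma tricomiU_log_nonint_eq:
  assumes "b \<notin> \<int>"
  shows "tricomiU_log_nonint a b w = of_real pi / sin (of_real pi * b) * connection_bracket a b w"
proof -
  have b: "b \<notin> \<int>\<^sub>\<le>\<^sub>0" "2 - b \<notin> \<int>\<^sub>\<le>\<^sub>0"
    using assms nonpos_Ints_Int[of b] nonpos_Ints_Int[of "2 - b"]
    by (auto dest: Ints_diff[of "2 :: complex", OF Ints_numeral])
  have 1: "Gamma (1 - b) * Gamma b = of_real pi / sin (of_real pi * b)"
    using Gamma_reflection_complex[of b] by (simp add: mult.commute)
  have 2: "Gamma (b - 1) * Gamma (2 - b) = - (of_real pi / sin (of_real pi * b))"
    using Gamma_reflection_complex[of "b - 1"] by (simp add: algebra_simps sin_diff)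
  have "tricomiU_log_nonint a b w =
      (Gamma (1 - b) * Gamma b) * (rGamma (a - b + 1) * kummerMr a b (exp w))
      + (Gamma (b - 1) * Gamma (2 - b)) * (rGamma a * exp ((1 - b) * w) * kummerMr (a - b + 1) (2 - b) (exp w))"
    unfolding tricomiU_log_nonint_def kummerM_eq_kummerMr[OF b(1)] kummerM_eq_kummerMr[OF b(2)]
    by (simp add: mult_ac)
  then show ?thesis
    unfolding 1 2 connection_bracket_def by (simp add: algebra_simps)
qed

text \<open>For b = 1 + n the second series degenerates, for b = 1 - n the first. The Pochhammer
  symbol that appears converts one reciprocal Gamma coefficient into the other, and z^n matches
  exp((1 - b) w), so the two terms are equal.\<close>

lemma connection_bracket_Int:
  assumes "b \<in> \<int>"
  shows "connection_bracket a b w = 0"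
proof -
  obtain m where m: "b = of_int m"
    using assms by (rule Ints_cases)
  show ?thesis
  proof (cases "m \<ge> 1")
    case True
    define n where "n = nat (m - 1)"
    have b: "b = 1 + of_nat n"
      using True by (simp add: m n_def)
    show ?thesis
      using kummerMr_at_nonpos_Int[of a n "exp w"] pochhammer_rGamma[of "a - of_nat n" n]
      by (simp add: connection_bracket_def b exp_minus exp_of_nat_mult)
  next
    case False
    define n where "n = nat (1 - m)"
    have b: "b = 1 - of_nat n"
      using False by (simp add: m n_def)
    show ?thesis
      using kummerMr_at_nonpos_Int[of "a + of_nat n" n "exp w"] pochhammer_rGamma[of a n]
      by (simp add: connection_bracket_def b exp_of_nat_mult)
  qed
qed

section \<open>Removing the singularity at integral b\<close>

lemma continuous_on_connection_bracket:
  "continuous_on S (\<lambda>(b, w). connection_bracket a b w)"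
  unfolding connection_bracket_def case_prod_unfold
  by (intro continuous_intros continuous_on_compose2[OF continuous_on_rGamma]) auto

lemma connection_bracket_holomorphic_parameter: "(\<lambda>b. connection_bracket a b w) holomorphic_on UNIV"
  unfolding connection_bracket_def by (intro holomorphic_intros) auto

lemma connection_bracket_holomorphic: "connection_bracket a b holomorphic_on UNIV"
  unfolding connection_bracket_def[abs_def] by (intro holomorphic_intros) auto

text \<open>Taylor's formula in \<open>\<beta>\<close>, with the second derivative bounded by Cauchy's inequality.\<close>

lemma uniform_limit_divided_difference:
  fixes F :: "complex \<Rightarrow> complex \<Rightarrow> complex"
  assumes cont: "continuous_on UNIV (\<lambda>(\<beta>, w). F \<beta> w)"
    and hol: "\<And>w. (\<lambda>\<beta>. F \<beta> w) holomorphic_on UNIV"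
    and zero: "\<And>w. F b w = 0"
    and K: "compact K"
  shows "uniform_limit K (\<lambda>\<beta> w. F \<beta> w / (\<beta> - b)) (\<lambda>w. deriv (\<lambda>\<beta>. F \<beta> w) b) (at b)"
proof -
  have "compact ((\<lambda>(\<beta>, w). F \<beta> w) ` (cball b 1 \<times> K))"
    by (intro compact_continuous_image compact_Times compact_cball K continuous_on_subset[OF cont]) auto
  then obtain C where "\<forall>x\<in>(\<lambda>(\<beta>, w). F \<beta> w) ` (cball b 1 \<times> K). norm x \<le> C"
    using compact_imp_bounded bounded_iff by metis
  then have C: "norm (F \<beta> w) \<le> C" if "\<beta> \<in> cball b 1" "w \<in> K" for \<beta> w
    using that by fastforce
  \<comment> \<open>The 8 is 2! / (1/2)^2: Cauchy's inequality for the second derivative on circles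
    of radius 1/2 about points of \<open>cball b (1 / 2)\<close>, which stay in
    \<open>cball b 1\<close>. The maximum with 1 makes e / B a valid radius even when C is not
    positive.\<close>
  define B where "B = max 1 (8 * C)"
  have bound: "norm (F \<beta> w / (\<beta> - b) - deriv (\<lambda>\<beta>. F \<beta> w) b) \<le> B * dist \<beta> b"
    if w: "w \<in> K" and \<beta>: "\<beta> \<noteq> b" "dist \<beta> b < 1 / 2" for \<beta> w
  proof -
    define g where "g i = (deriv ^^ i) (\<lambda>\<beta>. F \<beta> w)" for i
    have hol_g: "g i holomorphic_on UNIV" for i
      unfolding g_def by (intro holomorphic_higher_deriv hol) auto
    have "norm (g (Suc 1) x) \<le> 8 * C" if x: "x \<in> cball b (1 / 2)" for x
    proof -
      have "norm (g 2 x) \<le> fact 2 * C / (1 / 2) ^ 2"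
        unfolding g_def
      proof (rule Cauchy_inequality)
        show "(\<lambda>\<beta>. F \<beta> w) holomorphic_on ball x (1 / 2)"
          by (rule holomorphic_on_subset[OF hol]) auto
        show "continuous_on (cball x (1 / 2)) (\<lambda>\<beta>. F \<beta> w)"
          by (rule continuous_on_subset[OF holomorphic_on_imp_continuous_on[OF hol]]) auto
        fix y assume "norm (x - y) = 1 / 2"
        then have "dist b y \<le> 1"
          using x dist_triangle[of b y x] by (simp add: dist_norm)
        then show "norm (F y w) \<le> C"
          using C w by simp
      qed auto
      then show ?thesis
        by (simp add: numeral_2_eq_2)
    qed
    moreover have "(g i has_field_derivative g (Suc i) x) (at x within cball b (1 / 2))" for i x
      using holomorphic_derivI[OF hol_g open_UNIV, of x i] by (simp add: g_def has_field_derivative_at_within)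
    ultimately have "norm (g 0 \<beta> - (\<Sum>i\<le>1. g i b * (\<beta> - b) ^ i / fact i)) \<le>
        8 * C * norm (\<beta> - b) ^ Suc 1 / fact 1"
      using \<beta> by (intro complex_Taylor[of "cball b (1 / 2)"]) (auto simp: dist_commute)
    then have "norm (F \<beta> w - deriv (\<lambda>\<beta>. F \<beta> w) b * (\<beta> - b)) \<le> 8 * C * norm (\<beta> - b) ^ 2"
      by (simp add: g_def zero power2_eq_square)
    also have "\<dots> \<le> B * norm (\<beta> - b) ^ 2"
      by (intro mult_right_mono) (auto simp: B_def)
    also have "F \<beta> w - deriv (\<lambda>\<beta>. F \<beta> w) b * (\<beta> - b) =
        (F \<beta> w / (\<beta> - b) - deriv (\<lambda>\<beta>. F \<beta> w) b) * (\<beta> - b)"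
      using \<beta> by (simp add: left_diff_distrib)
    finally have "norm (F \<beta> w / (\<beta> - b) - deriv (\<lambda>\<beta>. F \<beta> w) b) * norm (\<beta> - b) \<le>
        (B * norm (\<beta> - b)) * norm (\<beta> - b)"
      by (simp only: norm_mult power2_eq_square mult.assoc)
    then show ?thesis
      using \<beta> by (simp add: dist_norm)
  qed
  show ?thesis
  proof (rule uniform_limitI)
    fix e :: real assume e: "0 < e"
    have "0 < B"
      by (simp add: B_def)
    have "\<forall>w\<in>K. dist (F \<beta> w / (\<beta> - b)) (deriv (\<lambda>\<beta>. F \<beta> w) b) < e"
      if "\<beta> \<noteq> b" "dist \<beta> b < min (1 / 2) (e / B)" for \<beta>
    proof
      fix w assume "w \<in> K"
      from bound[OF this] that
      have "dist (F \<beta> w / (\<beta> - b)) (deriv (\<lambda>\<beta>. F \<beta> w) b) \<le> B * dist \<beta> b"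
        by (simp add: dist_norm)
      also have "\<dots> < e"
        using that \<open>0 < B\<close> by (simp add: field_simps)
      finally show "dist (F \<beta> w / (\<beta> - b)) (deriv (\<lambda>\<beta>. F \<beta> w) b) < e" .
    qed
    then show "\<forall>\<^sub>F \<beta> in at b. \<forall>w\<in>K. dist (F \<beta> w / (\<beta> - b)) (deriv (\<lambda>\<beta>. F \<beta> w) b) < e"
      unfolding eventually_at using e \<open>0 < B\<close> by (intro exI[of _ "min (1 / 2) (e / B)"]) auto
  qed
qed

lemma eventually_at_Int_not_Int:
  fixes b :: "'a :: real_normed_algebra_1"
  assumes "b \<in> \<int>"
  shows "\<forall>\<^sub>F \<beta> in at b. \<beta> \<notin> \<int>"
  unfolding eventually_at
proof (intro exI[of _ 1] conjI ballI impI)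
  fix \<beta> :: 'a assume "\<beta> \<noteq> b \<and> dist \<beta> b < 1"
  then show "\<beta> \<notin> \<int>"
    using assms by (auto elim!: Ints_cases simp: dist_of_int)
qed simp

lemma tendsto_pi_over_sin_at_Int:
  fixes b :: complex
  assumes "b \<in> \<int>"
  obtains c where "((\<lambda>\<beta>. of_real pi * (\<beta> - b) / sin (of_real pi * \<beta>)) \<longlongrightarrow> c) (at b)"
proof -
  have sin_b: "sin (of_real pi * b) = 0"
    using assms by (auto simp: sin_eq_0 elim!: Ints_cases)
  then have cos_b: "cos (of_real pi * b) \<noteq> 0"
    using sin_cos_squared_add[of "of_real pi * b"] by auto
  have "((\<lambda>\<beta>. sin (of_real pi * \<beta>)) has_field_derivative cos (of_real pi * b) * of_real pi) (at b)"
    by (auto intro!: derivative_eq_intros)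
  then have "((\<lambda>\<beta>. sin (of_real pi * \<beta>) / (\<beta> - b)) \<longlongrightarrow> cos (of_real pi * b) * of_real pi) (at b)"
    by (simp add: has_field_derivative_iff sin_b)
  from tendsto_divide[OF tendsto_const this, of "of_real pi"] cos_b show thesis
    by (intro that) (auto simp: divide_simps)
qed

text \<open>Off the integers U is the product of pi (\<beta> - b) / sin(pi \<beta>), which converges
  because the zero of the sine is simple, and the divided difference of the bracket, which converges
  uniformly on K.\<close>

lemma uniform_limit_tricomiU_log:
  assumes b: "b \<in> \<int>" and K: "compact K"
  shows "uniform_limit K (tricomiU_log_nonint a) (tricomiU_log a b) (at b)"
proof -
  obtain c where c: "((\<lambda>\<beta>. of_real pi * (\<beta> - b) / sin (of_real pi * \<beta>)) \<longlongrightarrow> c) (at b)"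
    using tendsto_pi_over_sin_at_Int[OF b] .
  define D where "D w = deriv (\<lambda>\<beta>. connection_bracket a \<beta> w) b" for w
  \<comment> \<open>Proved for every compact set: singletons identify c * D w with the
    \<open>Lim\<close> in the definition of \<open>tricomiU_log\<close>, and the given set then
    yields the claim.\<close>
  have lim: "uniform_limit K (tricomiU_log_nonint a) (\<lambda>w. c * D w) (at b)" if K: "compact K" for K
  proof -
    have D: "uniform_limit K (\<lambda>\<beta> w. connection_bracket a \<beta> w / (\<beta> - b)) D (at b)"
      unfolding D_def
      by (intro uniform_limit_divided_difference continuous_on_connection_bracket
          connection_bracket_holomorphic_parameter connection_bracket_Int b K)
    have "continuous_on K (\<lambda>w. connection_bracket a \<beta> w / (\<beta> - b))" for \<beta>
      unfolding divide_inverse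
      by (intro continuous_on_mult continuous_on_const holomorphic_on_imp_continuous_on
          holomorphic_on_subset[OF connection_bracket_holomorphic]) auto
    then have "continuous_on K D"
      by (intro uniform_limit_theorem[OF _ D]) auto
    then have "bounded (D ` K)"
      by (intro compact_imp_bounded compact_continuous_image K)
    moreover have "uniform_limit K (\<lambda>\<beta> w. of_real pi * (\<beta> - b) / sin (of_real pi * \<beta>)) (\<lambda>w. c) (at b)"
      using c by (auto simp: uniform_limit_iff tendsto_iff elim: eventually_mono)
    ultimately have "uniform_limit K (\<lambda>\<beta> w. of_real pi * (\<beta> - b) / sin (of_real pi * \<beta>) *
        (connection_bracket a \<beta> w / (\<beta> - b))) (\<lambda>w. c * D w) (at b)"
      by (intro uniform_lim_mult D) (auto simp: image_constant_conv)
    moreover have "\<forall>\<^sub>F \<beta> in at b. \<forall>w\<in>K. of_real pi * (\<beta> - b) / sin (of_real pi * \<beta>) *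
        (connection_bracket a \<beta> w / (\<beta> - b)) = tricomiU_log_nonint a \<beta> w"
      using eventually_at_Int_not_Int[OF b]
    proof eventually_elim
      case (elim \<beta>)
      then have "\<beta> \<noteq> b"
        using b by auto
      then show ?case
        by (simp add: tricomiU_log_nonint_eq[OF elim])
    qed
    ultimately show ?thesis
      using uniform_limit_cong by fast
  qed
  have "tricomiU_log a b w = c * D w" for w
  proof -
    have "((\<lambda>\<beta>. tricomiU_log_nonint a \<beta> w) \<longlongrightarrow> c * D w) (at b)"
      using tendsto_uniform_limitI[OF lim[of "{w}"], of w] by simp
    then show ?thesis
      using b by (simp add: tricomiU_log_def tendsto_Lim)
  qed
  then have "tricomiU_log a b = (\<lambda>w. c * D w)"
    by auto
  with lim[OF K] show ?thesis
    by simp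
qed

lemma tricomiU_log_nonint_holomorphic:
  assumes "b \<notin> \<int>"
  shows "tricomiU_log_nonint a b holomorphic_on UNIV"
proof -
  have "tricomiU_log_nonint a b = (\<lambda>w. of_real pi / sin (of_real pi * b) * connection_bracket a b w)"
    using tricomiU_log_nonint_eq[OF assms] by auto
  then show ?thesis
    by (auto intro!: holomorphic_intros connection_bracket_holomorphic)
qed

lemma tricomiU_log_eq_nonint: "b \<notin> \<int> \<Longrightarrow> tricomiU_log a b = tricomiU_log_nonint a b"
  by (simp add: tricomiU_log_def fun_eq_iff)

text \<open>By Weierstrass's theorem a locally uniform limit of holomorphic functions is holomorphic
  and the derivatives converge to its derivative.\<close>

lemma tricomiU_log_at_Int:
  assumes b: "b \<in> \<int>"
  shows "tricomiU_log a b field_differentiable at w"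
    and "((\<lambda>\<beta>. deriv (tricomiU_log a \<beta>) w) \<longlongrightarrow> deriv (tricomiU_log a b) w) (at b)"
    and "((\<lambda>\<beta>. tricomiU_log a \<beta> w) \<longlongrightarrow> tricomiU_log a b w) (at b)"
    and "((\<lambda>\<beta>. tricomiU_log_nonint a \<beta> w) \<longlongrightarrow> tricomiU_log a b w) (at b)"
proof -
  have ev: "\<forall>\<^sub>F \<beta> in at b. continuous_on (cball w 1) (tricomiU_log_nonint a \<beta>) \<and>
      (\<forall>v\<in>ball w 1. (tricomiU_log_nonint a \<beta> has_field_derivative deriv (tricomiU_log a \<beta>) v) (at v))"
    using eventually_at_Int_not_Int[OF b]
  proof eventually_elim
    case (elim \<beta>)
    then show ?case
      using tricomiU_log_nonint_holomorphic[OF elim, of a]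
      by (auto simp: tricomiU_log_eq_nonint intro!: holomorphic_derivI[where S = UNIV]
          intro: holomorphic_on_imp_continuous_on holomorphic_on_subset)
  qed
  from has_complex_derivative_uniform_limit[OF ev uniform_limit_tricomiU_log[OF b compact_cball]]
  obtain g' where g': "\<And>v. v \<in> ball w 1 \<Longrightarrow> (tricomiU_log a b has_field_derivative g' v) (at v) \<and>
      ((\<lambda>\<beta>. deriv (tricomiU_log a \<beta>) v) \<longlongrightarrow> g' v) (at b)"
    by (metis trivial_limit_at zero_less_one)
  from g'[of w] show "tricomiU_log a b field_differentiable at w"
    by (auto simp: field_differentiable_def)
  from g'[of w] show "((\<lambda>\<beta>. deriv (tricomiU_log a \<beta>) w) \<longlongrightarrow> deriv (tricomiU_log a b) w) (at b)"
    by (auto dest: DERIV_imp_deriv)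
  show *: "((\<lambda>\<beta>. tricomiU_log_nonint a \<beta> w) \<longlongrightarrow> tricomiU_log a b w) (at b)"
    using tendsto_uniform_limitI[OF uniform_limit_tricomiU_log[OF b], of "{w}" w] by simp
  show "((\<lambda>\<beta>. tricomiU_log a \<beta> w) \<longlongrightarrow> tricomiU_log a b w) (at b)"
    by (rule Lim_transform_eventually[OF *])
      (use eventually_at_Int_not_Int[OF b] in \<open>auto elim!: eventually_mono simp: tricomiU_log_eq_nonint\<close>)
qed

lemma tricomiU_log_holomorphic: "tricomiU_log a b holomorphic_on UNIV"
proof (cases "b \<in> \<int>")
  case True
  then show ?thesis
    by (simp add: holomorphic_on_def tricomiU_log_at_Int)
next
  case False
  then show ?thesis
    by (simp add: tricomiU_log_eq_nonint tricomiU_log_nonint_holomorphic)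
qed

section \<open>The Wronskian of the two continuations\<close>

text \<open>All sines cancel: the prefactor pi / sin(pi b) enters squared, while the jump of the
  power and the Wronskian of the Kummer solutions contribute one sine each. This is why the
  right-hand side remains meaningful at integral b.\<close>

lemma tricomiU_log_continuation_wronskian_nonint:
  fixes a b w :: complex
  assumes b: "b \<notin> \<int>"
  defines "T \<equiv> tricomiU_log a b"
  shows "deriv T (w + \<i> * of_real pi) * T (w - \<i> * of_real pi)
      - T (w + \<i> * of_real pi) * deriv T (w - \<i> * of_real pi)
    = - 2 * of_real pi * \<i> * rGamma a * rGamma (a - b + 1) * exp ((1 - b) * w) * exp (- exp w)"
proof -
  define s where "s = sin (of_real pi * b)"
  define c where "c = of_real pi / s"
  define A where "A = rGamma (a - b + 1)"
  define B where "B = rGamma a"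
  let ?M = "kummerMr a b" and ?M' = "kummerMr' a b"
  let ?N = "kummerMr (a - b + 1) (2 - b)" and ?N' = "kummerMr' (a - b + 1) (2 - b)"
  have s: "s \<noteq> 0"
    using b by (auto simp: s_def sin_eq_0 Ints_def)
  have T: "T v = c * (A * ?M (exp v) - B * exp ((1 - b) * v) * ?N (exp v))" for v
    unfolding T_def tricomiU_log_eq_nonint[OF b] tricomiU_log_nonint_eq[OF b]
    by (simp add: connection_bracket_def c_def s_def A_def B_def)
  have "(T has_field_derivative c * (A * (exp v * ?M' (exp v))
      - B * exp ((1 - b) * v) * ((1 - b) * ?N (exp v) + exp v * ?N' (exp v)))) (at v)" for v
  proof -
    have "((\<lambda>v. ?M (exp v)) has_field_derivative ?M' (exp v) * exp v) (at v)"
      "((\<lambda>v. ?N (exp v)) has_field_derivative ?N' (exp v) * exp v) (at v)"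
      by (rule DERIV_chain2[OF kummerMr_has_field_derivative DERIV_exp])+
    then show ?thesis
      unfolding T[abs_def] by (auto intro!: derivative_eq_intros simp: algebra_simps)
  qed
  then have T': "deriv T v = c * (A * (exp v * ?M' (exp v))
      - B * exp ((1 - b) * v) * ((1 - b) * ?N (exp v) + exp v * ?N' (exp v)))" for v
    by (rule DERIV_imp_deriv)
  define z where "z = - exp w"
  have z: "exp (w + \<i> * of_real pi) = z" "exp (w - \<i> * of_real pi) = z"
    by (simp_all add: z_def exp_add exp_diff)
  define E1 where "E1 = exp ((1 - b) * (w + \<i> * of_real pi))"
  define E2 where "E2 = exp ((1 - b) * (w - \<i> * of_real pi))"
  have E: "E1 - E2 = 2 * \<i> * s * exp ((1 - b) * w)"
  proof -
    define u where "u = \<i> * (of_real pi * b)"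
    have "(1 - b) * (w + \<i> * of_real pi) = (1 - b) * w + \<i> * of_real pi - u"
      "(1 - b) * (w - \<i> * of_real pi) = (1 - b) * w - \<i> * of_real pi + u"
      by (simp_all add: u_def algebra_simps)
    then have "E1 = - (exp ((1 - b) * w) * exp (- u))" "E2 = - (exp ((1 - b) * w) * exp u)"
      by (simp_all add: E1_def E2_def exp_add exp_diff exp_minus divide_inverse)
    moreover have "2 * \<i> * s = exp u - exp (- u)"
      by (simp add: s_def u_def sin_exp_eq)
    ultimately show ?thesis
      by (simp only:) (simp add: left_diff_distrib)
  qed
  \<comment> \<open>The terms quadratic in one solution cancel, since their coefficients A^2 and E1
    E2 B^2 are symmetric in the two continuations. The mixed terms combine to E1 - E2 times the
    cleared Wronskian.\<close>
  have "deriv T (w + \<i> * of_real pi) * T (w - \<i> * of_real pi)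
      - T (w + \<i> * of_real pi) * deriv T (w - \<i> * of_real pi)
    = - (c * c * (A * B)) * (E1 - E2) *
      ((1 - b) * ?M z * ?N z + z * (?M z * ?N' z - ?M' z * ?N z))"
    unfolding T T' z E1_def[symmetric] E2_def[symmetric] by algebra
  also have "\<dots> = - (c * c * (A * B)) * (2 * \<i> * s * exp ((1 - b) * w)) *
      (s / of_real pi * exp z)"
    unfolding kummerMr_wronskian E s_def ..
  also have "\<dots> = - 2 * of_real pi * \<i> * B * A * exp ((1 - b) * w) * exp z"
    using s by (simp add: c_def)
  finally show ?thesis
    by (simp add: A_def B_def z_def)
qed

lemma tricomiU_log_continuation_wronskian:
  fixes a b w :: complex
  defines "T \<equiv> tricomiU_log a b"
  shows "deriv T (w + \<i> * of_real pi) * T (w - \<i> * of_real pi)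
      - T (w + \<i> * of_real pi) * deriv T (w - \<i> * of_real pi)
    = - 2 * of_real pi * \<i> * rGamma a * rGamma (a - b + 1) * exp ((1 - b) * w) * exp (- exp w)"
proof (cases "b \<in> \<int>")
  case False
  then show ?thesis
    unfolding T_def by (rule tricomiU_log_continuation_wronskian_nonint)
next
  case b: True
  let ?L = "\<lambda>\<beta>. deriv (tricomiU_log a \<beta>) (w + \<i> * of_real pi) * tricomiU_log a \<beta> (w - \<i> * of_real pi)
      - tricomiU_log a \<beta> (w + \<i> * of_real pi) * deriv (tricomiU_log a \<beta>) (w - \<i> * of_real pi)"
  let ?R = "\<lambda>\<beta>. - 2 * of_real pi * \<i> * rGamma a * rGamma (a - \<beta> + 1) * exp ((1 - \<beta>) * w) * exp (- exp w)"
  have L: "(?L \<longlongrightarrow> ?L b) (at b)"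
    by (intro tendsto_intros tricomiU_log_at_Int b)
  have "isCont ?R b"
    by (intro continuous_intros)
  then have R: "(?R \<longlongrightarrow> ?R b) (at b)"
    by (simp add: isCont_def)
  have "\<forall>\<^sub>F \<beta> in at b. ?R \<beta> = ?L \<beta>"
    using eventually_at_Int_not_Int[OF b]
    by eventually_elim (rule tricomiU_log_continuation_wronskian_nonint[symmetric])
  from tendsto_unique[OF trivial_limit_at L Lim_transform_eventually[OF R this]] show ?thesis
    unfolding T_def .
qed

section \<open>Real and imaginary parts of U on the cut\<close>

lemma not_Int_imp_not_nonpos_Int:
  fixes b :: "'a :: ring_char_0"
  assumes "b \<notin> \<int>"
  shows "b \<notin> \<int>\<^sub>\<le>\<^sub>0" "2 - b \<notin> \<int>\<^sub>\<le>\<^sub>0"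
proof -
  show "b \<notin> \<int>\<^sub>\<le>\<^sub>0"
    using assms nonpos_Ints_Int by blast
  show "2 - b \<notin> \<int>\<^sub>\<le>\<^sub>0"
    using assms Ints_diff[OF Ints_numeral, of "2 - b" "num.Bit0 num.One"] nonpos_Ints_Int[of "2 - b"] by auto
qed

text \<open>The sign \<sigma> treats both sides of the cut at once. Kummer's transformation at -x
  turns the first parameters a and a - b + 1 into b - a and 1 - a.\<close>

lemma tricomiU_log_nonint_continuation:
  fixes a b x :: real
  assumes b: "b \<notin> \<int>" and x: "0 < x" and \<sigma>: "\<sigma> = 1 \<or> \<sigma> = - 1"
  shows "tricomiU_log_nonint (of_real a) (of_real b) (of_real (ln x) + of_real \<sigma> * (\<i> * of_real pi))
    = of_real (U_R_nonint a b x) + of_real \<sigma> * (\<i> * of_real (U_I_nonint a b x))"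
proof -
  define w where "w = complex_of_real (ln x) + of_real \<sigma> * (\<i> * of_real pi)"
  define B where "B = complex_of_real b"
  define A where "A = complex_of_real a"
  have notint: "b \<notin> \<int>\<^sub>\<le>\<^sub>0" "2 - b \<notin> \<int>\<^sub>\<le>\<^sub>0" "B \<notin> \<int>\<^sub>\<le>\<^sub>0" "2 - B \<notin> \<int>\<^sub>\<le>\<^sub>0"
    using not_Int_imp_not_nonpos_Int[of b] not_Int_imp_not_nonpos_Int[of B] b
    by (auto simp: of_real_in_Ints_iff B_def)
  have exp_w: "exp w = - of_real x"
    using \<sigma> x by (auto simp: w_def exp_add exp_minus exp_of_real[symmetric] exp_of_real)
  have "kummerM A B (exp w) = of_real (exp (- x) * kummerM (b - a) b x)"
    unfolding exp_w using kummer_transformation[OF notint(3), of A "- of_real x"] kummerM_of_real[OF notint(1), of "b - a" x]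
    by (simp add: A_def B_def exp_of_real[symmetric])
  moreover have "kummerM (A - B + 1) (2 - B) (exp w) = of_real (exp (- x) * kummerM (1 - a) (2 - b) x)"
    unfolding exp_w using kummer_transformation[OF notint(4), of "A - B + 1" "- of_real x"] kummerM_of_real[OF notint(2), of "1 - a" x]
    by (simp add: A_def B_def exp_of_real[symmetric])
  \<comment> \<open>The phase is \<sigma> (pi - pi b), so the cosine changes sign and the sine does
    not; this is the origin of the minus sign in \<open>U_R\<close>.\<close>
  moreover have "exp ((1 - B) * w) = of_real (x powr (1 - b)) * (- of_real (cos (pi * b)) + of_real \<sigma> * (\<i> * of_real (sin (pi * b))))"
  proof -
    have "(1 - B) * w = of_real ((1 - b) * ln x) + \<i> * of_real (\<sigma> * pi - \<sigma> * (pi * b))"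
      by (simp add: w_def B_def algebra_simps)
    then have "exp ((1 - B) * w) = of_real (exp ((1 - b) * ln x)) * cis (\<sigma> * pi - \<sigma> * (pi * b))"
      by (simp only: exp_add exp_of_real cis_conv_exp)
    moreover have "cis (\<sigma> * pi - \<sigma> * (pi * b)) = - of_real (cos (pi * b)) + of_real \<sigma> * (\<i> * of_real (sin (pi * b)))"
      using \<sigma> by (auto simp: complex_eq_iff cos_diff sin_diff cos_add sin_add)
    ultimately show ?thesis
      using x by (simp add: powr_def)
  qed
  moreover have "Gamma (1 - B) = of_real (Gamma (1 - b))" "Gamma (B - 1) = of_real (Gamma (b - 1))"
    "rGamma A = of_real (rGamma a)" "rGamma (A - B + 1) = of_real (rGamma (a - b + 1))"
    unfolding A_def B_def Gamma_complex_of_real[symmetric] rGamma_complex_of_real[symmetric] by simp_all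
  ultimately have "tricomiU_log_nonint A B w = of_real (U_R_nonint a b x) + of_real \<sigma> * (\<i> * of_real (U_I_nonint a b x))"
    unfolding tricomiU_log_nonint_def U_R_nonint_def U_I_nonint_def
    by (simp only:) (simp add: algebra_simps)
  then show ?thesis
    by (simp add: A_def B_def w_def)
qed

lemma U_R_U_I_nonint_tendsto:
  fixes a b x :: real
  assumes b: "b \<in> \<int>" and x: "0 < x"
  shows "((\<lambda>\<beta>. U_R_nonint a \<beta> x) \<longlongrightarrow> Re (tricomiU_upper a b x)) (at b)"
    and "((\<lambda>\<beta>. U_I_nonint a \<beta> x) \<longlongrightarrow> Im (tricomiU_upper a b x)) (at b)"
    and "tricomiU_lower a b x = cnj (tricomiU_upper a b x)"
proof -
  have B: "complex_of_real b \<in> \<int>"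
    using b by (simp add: of_real_in_Ints_iff)
  \<comment> \<open>\<open>U_R\<close> and \<open>U_I\<close> are limits over real \<beta>,
    \<open>tricomiU_log\<close> is one over complex \<beta>; this restricts the complex limit to the
    real line.\<close>
  have of_real_at: "filterlim complex_of_real (at (of_real b)) (at b)"
    by (auto simp: filterlim_at intro!: tendsto_intros eventually_neq_at_within)
  let ?w = "\<lambda>\<sigma>. complex_of_real (ln x) + of_real \<sigma> * (\<i> * of_real pi)"
  have lim: "((\<lambda>\<beta>. of_real (U_R_nonint a \<beta> x) + of_real \<sigma> * (\<i> * of_real (U_I_nonint a \<beta> x)))
      \<longlongrightarrow> tricomiU_log (of_real a) (of_real b) (?w \<sigma>)) (at b)" if \<sigma>: "\<sigma> = 1 \<or> \<sigma> = - 1" for \<sigma>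
  proof (rule Lim_transform_eventually)
    show "((\<lambda>\<beta>. tricomiU_log_nonint (of_real a) (of_real \<beta>) (?w \<sigma>))
        \<longlongrightarrow> tricomiU_log (of_real a) (of_real b) (?w \<sigma>)) (at b)"
      by (rule filterlim_compose[OF tricomiU_log_at_Int(4)[OF B] of_real_at])
    show "\<forall>\<^sub>F \<beta> in at b. tricomiU_log_nonint (of_real a) (of_real \<beta>) (?w \<sigma>) =
        of_real (U_R_nonint a \<beta> x) + of_real \<sigma> * (\<i> * of_real (U_I_nonint a \<beta> x))"
      using eventually_at_Int_not_Int[OF b]
      by eventually_elim (rule tricomiU_log_nonint_continuation[OF _ x \<sigma>])
  qed
  have upper: "((\<lambda>\<beta>. of_real (U_R_nonint a \<beta> x) + \<i> * of_real (U_I_nonint a \<beta> x))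
      \<longlongrightarrow> tricomiU_upper a b x) (at b)"
    using lim[of 1] by (simp add: tricomiU_upper_def)
  show "((\<lambda>\<beta>. U_R_nonint a \<beta> x) \<longlongrightarrow> Re (tricomiU_upper a b x)) (at b)"
    "((\<lambda>\<beta>. U_I_nonint a \<beta> x) \<longlongrightarrow> Im (tricomiU_upper a b x)) (at b)"
    using tendsto_Re[OF upper] tendsto_Im[OF upper] by simp_all
  have "((\<lambda>\<beta>. of_real (U_R_nonint a \<beta> x) - \<i> * of_real (U_I_nonint a \<beta> x))
      \<longlongrightarrow> tricomiU_lower a b x) (at b)"
    using lim[of "- 1"] by (simp add: tricomiU_lower_def)
  moreover have "((\<lambda>\<beta>. of_real (U_R_nonint a \<beta> x) - \<i> * of_real (U_I_nonint a \<beta> x))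
      \<longlongrightarrow> cnj (tricomiU_upper a b x)) (at b)"
    using tendsto_cnj[OF upper] by simp
  ultimately show "tricomiU_lower a b x = cnj (tricomiU_upper a b x)"
    by (rule tendsto_unique[OF trivial_limit_at])
qed

lemma tricomiU_upper_eq:
  assumes "0 < x"
  shows "tricomiU_upper a b x = of_real (U_R a b x) + \<i> * of_real (U_I a b x)"
proof (cases "b \<in> \<int>")
  case True
  then show ?thesis
    using U_R_U_I_nonint_tendsto(1,2)[OF True assms, of a, THEN tendsto_Lim[OF trivial_limit_at]]
    by (simp add: U_R_def U_I_def complex_eq_iff)
next
  case False
  then show ?thesis
    using tricomiU_log_nonint_continuation[OF False assms, of 1 a]
    by (simp add: U_R_def U_I_def tricomiU_upper_def tricomiU_log_eq_nonint of_real_in_Ints_iff)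
qed

lemma tricomiU_lower_eq_cnj:
  assumes "0 < x"
  shows "tricomiU_lower a b x = cnj (tricomiU_upper a b x)"
proof (cases "b \<in> \<int>")
  case True
  then show ?thesis
    by (rule U_R_U_I_nonint_tendsto(3)[OF _ assms])
next
  case False
  then show ?thesis
    using tricomiU_log_nonint_continuation[OF False assms, of 1 a]
      tricomiU_log_nonint_continuation[OF False assms, of "- 1" a]
    by (simp add: tricomiU_upper_def tricomiU_lower_def tricomiU_log_eq_nonint of_real_in_Ints_iff)
qed

text \<open>This justifies "by continuity in b": \<open>Lim\<close> alone does not assert that a
  limit exists.\<close>

lemma isCont_U_R_U_I:
  assumes b: "b \<in> \<int>" and x: "0 < x"
  shows "isCont (\<lambda>\<beta>. U_R a \<beta> x) b" "isCont (\<lambda>\<beta>. U_I a \<beta> x) b"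
proof -
  have "\<forall>\<^sub>F \<beta> in at b. U_R_nonint a \<beta> x = U_R a \<beta> x" "\<forall>\<^sub>F \<beta> in at b. U_I_nonint a \<beta> x = U_I a \<beta> x"
    using eventually_at_Int_not_Int[OF b] by (auto elim!: eventually_mono simp: U_R_def U_I_def)
  note this[THEN Lim_transform_eventually[rotated]]
  from this(1)[OF U_R_U_I_nonint_tendsto(1)[OF b x]] this(2)[OF U_R_U_I_nonint_tendsto(2)[OF b x]]
  show "isCont (\<lambda>\<beta>. U_R a \<beta> x) b" "isCont (\<lambda>\<beta>. U_I a \<beta> x) b"
    using tricomiU_upper_eq[OF x, of a b] by (simp_all add: isCont_def)
qed

section \<open>Boundary values of f and the jump\<close>

lemma deriv_tricomiU:
  assumes "z \<notin> \<real>\<^sub>\<le>\<^sub>0"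
  shows "deriv (tricomiU a b) z = deriv (tricomiU_log a b) (Ln z) / z"
proof (rule DERIV_imp_deriv)
  have "((\<lambda>z. tricomiU_log a b (Ln z)) has_field_derivative deriv (tricomiU_log a b) (Ln z) * inverse z) (at z)"
    by (rule DERIV_chain2[OF holomorphic_derivI[OF tricomiU_log_holomorphic open_UNIV UNIV_I]
        has_field_derivative_Ln[OF assms]])
  then show "(tricomiU a b has_field_derivative deriv (tricomiU_log a b) (Ln z) / z) (at z)"
    by (simp add: tricomiU_def[abs_def] divide_inverse)
qed

text \<open>\<open>Ln\<close> is discontinuous at the limit point, but Ln(-z) is continuous there,
  and Ln z differs from it by i pi with the sign of Im z.\<close>

lemma tendsto_Ln_at_cut:
  assumes k: "0 < k" and x: "0 < x" and \<sigma>: "\<sigma> = 1 \<or> \<sigma> = - 1"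
  shows "((\<lambda>\<epsilon>. Ln (of_real k * (- of_real x + of_real \<sigma> * (\<i> * of_real \<epsilon>)))) \<longlongrightarrow>
    of_real (ln (k * x)) + of_real \<sigma> * (\<i> * of_real pi)) (at_right 0)"
proof -
  let ?z = "\<lambda>\<epsilon>. of_real k * (- of_real x + of_real \<sigma> * (\<i> * of_real \<epsilon>)) :: complex"
  have "((\<lambda>\<epsilon>. Ln (- ?z \<epsilon>) + of_real \<sigma> * (\<i> * of_real pi)) \<longlongrightarrow>
      Ln (- ?z 0) + of_real \<sigma> * (\<i> * of_real pi)) (at_right 0)"
    using k x by (intro tendsto_intros) (auto simp: complex_nonpos_Reals_iff mult_le_0_iff mult_less_0_iff)
  moreover have "Ln (- ?z 0) = of_real (ln (k * x))"
    using k x Ln_of_real[of "k * x"] by simp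
  moreover have "\<forall>\<^sub>F \<epsilon> in at_right 0. Ln (- ?z \<epsilon>) + of_real \<sigma> * (\<i> * of_real pi) = Ln (?z \<epsilon>)"
    using eventually_at_right_less[of 0]
  proof eventually_elim
    case (elim \<epsilon>)
    have "?z \<epsilon> \<noteq> 0" "0 < k * \<epsilon>"
      using k x elim by (auto simp: complex_eq_iff)
    with \<sigma> k x show ?case
      by (subst Ln_minus) (auto simp: not_le)
  qed
  ultimately show ?thesis
    by (auto intro: Lim_transform_eventually)
qed

text \<open>Since T is entire, a boundary value on the cut is ordinary continuity of T and its
  derivative at w; only \<open>Ln\<close> depends on the side. The denominator -kx is the limit of
  the chain rule factor z. The approach points lie off the cut, so f is known there.\<close>

lemma gen_fun_tendsto_at_cut:
  fixes a b k x \<sigma> :: real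
  defines "w \<equiv> complex_of_real (ln (k * x)) + of_real \<sigma> * (\<i> * of_real pi)"
  defines "T \<equiv> tricomiU_log (of_real a) (of_real b)"
  assumes k: "0 < k" and x: "0 < x" and \<sigma>: "\<sigma> = 1 \<or> \<sigma> = - 1" and T: "T w \<noteq> 0"
    and f: "\<And>z. z \<notin> \<real>\<^sub>\<le>\<^sub>0 \<Longrightarrow> f z = gen_fun k a b z"
  shows "((\<lambda>\<epsilon>. f (- of_real x + of_real \<sigma> * (\<i> * of_real \<epsilon>))) \<longlongrightarrow>
    of_real (k / a) * (deriv T w / (- of_real (k * x)) / T w) - (if b = 0 then 0 else of_real (k / b))) (at_right 0)"
proof -
  let ?\<zeta> = "\<lambda>\<epsilon>. - of_real x + of_real \<sigma> * (\<i> * of_real \<epsilon>) :: complex"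
  let ?z = "\<lambda>\<epsilon>. of_real k * ?\<zeta> \<epsilon>"
  have Ln: "((\<lambda>\<epsilon>. Ln (?z \<epsilon>)) \<longlongrightarrow> w) (at_right 0)"
    unfolding w_def by (rule tendsto_Ln_at_cut[OF k x \<sigma>])
  have hol: "T holomorphic_on UNIV" "deriv T holomorphic_on UNIV"
    unfolding T_def by (intro tricomiU_log_holomorphic holomorphic_deriv; simp)+
  then have cont: "isCont T w" "isCont (deriv T) w"
    by (auto dest!: holomorphic_on_imp_continuous_on simp: continuous_on_eq_continuous_at)
  have "((\<lambda>\<epsilon>. ?z \<epsilon>) \<longlongrightarrow> of_real k * (- of_real x + of_real \<sigma> * (\<i> * of_real 0))) (at_right 0)"
    by (intro tendsto_intros)
  then have z: "((\<lambda>\<epsilon>. ?z \<epsilon>) \<longlongrightarrow> - of_real (k * x)) (at_right 0)"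
    by simp
  have "((\<lambda>\<epsilon>. of_real (k / a) * (deriv T (Ln (?z \<epsilon>)) / ?z \<epsilon> / T (Ln (?z \<epsilon>))) - (if b = 0 then 0 else of_real (k / b))) \<longlongrightarrow>
    of_real (k / a) * (deriv T w / (- of_real (k * x)) / T w) - (if b = 0 then 0 else of_real (k / b))) (at_right 0)"
    by (intro tendsto_diff tendsto_mult tendsto_divide tendsto_const z T
        isCont_tendsto_compose[OF cont(1)] isCont_tendsto_compose[OF cont(2)] Ln) (use k x in auto)
  moreover have "\<forall>\<^sub>F \<epsilon> in at_right 0. of_real (k / a) * (deriv T (Ln (?z \<epsilon>)) / ?z \<epsilon> / T (Ln (?z \<epsilon>)))
      - (if b = 0 then 0 else of_real (k / b)) = f (?\<zeta> \<epsilon>)"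
    using eventually_at_right_less[of 0]
  proof eventually_elim
    case (elim \<epsilon>)
    have *: "?\<zeta> \<epsilon> \<notin> \<real>\<^sub>\<le>\<^sub>0" "?z \<epsilon> \<notin> \<real>\<^sub>\<le>\<^sub>0"
      using \<sigma> k elim by (auto simp: complex_nonpos_Reals_iff)
    show ?case
      unfolding f[OF *(1)] gen_fun_def deriv_tricomiU[OF *(2)] T_def tricomiU_def ..
  qed
  ultimately show ?thesis
    by (rule Lim_transform_eventually)
qed

lemma jump_tendsto:
  fixes a b k x :: real
  assumes a: "a \<noteq> 0" and k: "0 < k" and x: "0 < x" and U: "tricomiU_upper a b (k * x) \<noteq> 0"
    and f: "\<And>z. z \<notin> \<real>\<^sub>\<le>\<^sub>0 \<Longrightarrow> f z = gen_fun k a b z"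
  shows "(jump f x \<longlongrightarrow> 2 * of_real pi * \<i> * of_real (k * (k * x) powr (- b) * exp (- (k * x))
      * (rGamma (a + 1) * rGamma (a - b + 1))
      * (1 / ((U_R a b (k * x))\<^sup>2 + (U_I a b (k * x))\<^sup>2)))) (at_right 0)"
proof -
  define y where "y = k * x"
  have y: "0 < y"
    using k x by (simp add: y_def)
  define T where "T = tricomiU_log (of_real a) (of_real b)"
  define w where "w = complex_of_real (ln y)"
  define p where "p = w + \<i> * of_real pi"
  define m where "m = w - \<i> * of_real pi"
  \<comment> \<open>By conjugation the one hypothesis on the upper continuation makes both
    denominators nonzero.\<close>
  have Tp: "T p = tricomiU_upper a b y" and Tm: "T m = cnj (tricomiU_upper a b y)"
    using tricomiU_lower_eq_cnj[OF y, of a b]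
    by (simp_all add: T_def p_def m_def w_def tricomiU_upper_def tricomiU_lower_def)
  then have nz: "T p \<noteq> 0" "T m \<noteq> 0"
    using U by (simp_all add: y_def)
  define c where "c = (if b = 0 then 0 else complex_of_real (k / b))"
  let ?g = "\<lambda>v. of_real (k / a) * (deriv T v / (- of_real y) / T v)"
  have "((\<lambda>\<epsilon>. f (- of_real x + \<i> * of_real \<epsilon>)) \<longlongrightarrow> ?g p - c) (at_right 0)"
    using gen_fun_tendsto_at_cut[OF k x, of 1 a b f] f nz
    by (simp add: T_def p_def w_def y_def c_def)
  moreover have "((\<lambda>\<epsilon>. f (- of_real x - \<i> * of_real \<epsilon>)) \<longlongrightarrow> ?g m - c) (at_right 0)"
    using gen_fun_tendsto_at_cut[OF k x, of "- 1" a b f] f nz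
    by (simp add: T_def m_def w_def y_def c_def)
  ultimately have "(jump f x \<longlongrightarrow> (?g p - c) - (?g m - c)) (at_right 0)"
    unfolding jump_def[abs_def] by (rule tendsto_diff)
  also have "(?g p - c) - (?g m - c) =
      - of_real (k / a) / of_real y * (deriv T p / T p - deriv T m / T m)"
    by (simp add: right_diff_distrib mult.assoc)
  also have "deriv T p / T p - deriv T m / T m = (deriv T p * T m - T p * deriv T m) / (T p * T m)"
    using nz by (simp add: diff_frac_eq mult.commute)
  also have "deriv T p * T m - T p * deriv T m =
      - 2 * of_real pi * \<i> * of_real (rGamma a * rGamma (a - b + 1) * y powr (1 - b) * exp (- y))"
  proof -
    have "exp ((1 - of_real b) * w) = complex_of_real (y powr (1 - b))"
      using y by (simp add: w_def powr_def exp_of_real[symmetric])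
    moreover have "exp (- exp w) = complex_of_real (exp (- y))"
      using y exp_of_real[of "- y", where 'a = complex] by (simp add: w_def exp_of_real)
    moreover have "rGamma (of_real a - of_real b + 1) = complex_of_real (rGamma (a - b + 1))"
      unfolding rGamma_complex_of_real[symmetric] by simp
    ultimately show ?thesis
      using tricomiU_log_continuation_wronskian[of "of_real a" "of_real b" w]
      by (simp add: T_def p_def m_def rGamma_complex_of_real)
  qed
  also have "T p * T m = of_real ((U_R a b y)\<^sup>2 + (U_I a b y)\<^sup>2)"
    unfolding Tp Tm complex_mult_cnj using tricomiU_upper_eq[OF y, of a b] by simp
  \<comment> \<open>The factor a cancels the 1/a of k/a, and in the next step y cancels the 1/y left
    by the chain rule.\<close>
  also have "rGamma a = a * rGamma (a + 1)"
    by (simp add: rGamma_plus1)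
  also have "y powr (1 - b) = y * y powr (- b)"
    using y by (simp add: powr_diff powr_minus divide_inverse)
  finally show ?thesis
    using a y by (simp add: y_def[symmetric] mult_ac)
qed

theorem mainTheorem4:
  fixes \<alpha>1 \<alpha>2 \<alpha>3 k a b :: real and f :: "complex \<Rightarrow> complex" and \<mu> :: "real \<Rightarrow> complex"
  assumes "\<alpha>1 > 0" and "\<alpha>3 \<noteq> 0"
    and "k = 1 / \<alpha>1" and "a = \<alpha>3 / \<alpha>1" and "b = - 1 - \<alpha>2 / \<alpha>1"
    and "\<And>z. z \<notin> \<real>\<^sub>\<le>\<^sub>0 \<Longrightarrow> f z = gen_fun k a b z"
    and "\<mu> = stieltjes_density f"
  shows "(\<forall>x>0. tricomiU_upper a b x = of_real (U_R a b x) + \<i> * of_real (U_I a b x)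
              \<and> tricomiU_lower a b x = of_real (U_R a b x) - \<i> * of_real (U_I a b x))
    \<and> (b \<in> \<int> \<longrightarrow> (\<forall>x>0. isCont (\<lambda>\<beta>. U_R a \<beta> x) b \<and> isCont (\<lambda>\<beta>. U_I a \<beta> x) b))
    \<and> (\<forall>x>0. tricomiU_upper a b (k * x) \<noteq> 0 \<longrightarrow>
          (\<exists>l. (jump f x \<longlongrightarrow> l) (at_right 0))
        \<and> \<mu> x = of_real (k * (k * x) powr (- b) * exp (- (k * x))
                          * (rGamma (a + 1) * rGamma (a - b + 1))
                          * (1 / ((U_R a b (k * x))\<^sup>2 + (U_I a b (k * x))\<^sup>2)))
        \<and> k * (k * x) powr (- b) * exp (- (k * x))
            * (1 / ((U_R a b (k * x))\<^sup>2 + (U_I a b (k * x))\<^sup>2)) > 0)"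
proof (intro conjI allI impI)
  have k: "0 < k" and a: "a \<noteq> 0"
    using assms by auto
  fix x :: real assume x: "0 < x"
  show "tricomiU_upper a b x = of_real (U_R a b x) + \<i> * of_real (U_I a b x)"
    by (rule tricomiU_upper_eq[OF x])
  show "tricomiU_lower a b x = of_real (U_R a b x) - \<i> * of_real (U_I a b x)"
    by (simp add: tricomiU_lower_eq_cnj[OF x] tricomiU_upper_eq[OF x])
  show "isCont (\<lambda>\<beta>. U_R a \<beta> x) b" "isCont (\<lambda>\<beta>. U_I a \<beta> x) b" if "b \<in> \<int>"
    by (rule isCont_U_R_U_I[OF that x])+
  assume U: "tricomiU_upper a b (k * x) \<noteq> 0"
  note lim = jump_tendsto[OF a k x U assms(6)]
  from lim show "\<exists>l. (jump f x \<longlongrightarrow> l) (at_right 0)"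
    by blast
  from tendsto_Lim[OF _ lim]
  show "\<mu> x = of_real (k * (k * x) powr (- b) * exp (- (k * x))
      * (rGamma (a + 1) * rGamma (a - b + 1))
      * (1 / ((U_R a b (k * x))\<^sup>2 + (U_I a b (k * x))\<^sup>2)))"
    unfolding assms(7) stieltjes_density_def by simp
  \<comment> \<open>Strict positivity depends on this: with a zero denominator the quotient would be
    1/0 = 0.\<close>
  have "U_R a b (k * x) \<noteq> 0 \<or> U_I a b (k * x) \<noteq> 0"
    using U tricomiU_upper_eq[of "k * x" a b] k x by auto
  then have "0 < (U_R a b (k * x))\<^sup>2 + (U_I a b (k * x))\<^sup>2"
    by (simp add: sum_power2_gt_zero_iff)
  then show "0 < k * (k * x) powr (- b) * exp (- (k * x))
      * (1 / ((U_R a b (k * x))\<^sup>2 + (U_I a b (k * x))\<^sup>2))"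
    using k x by simp
qed

end
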